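(* Let $N,n\ge1$. For $1\le i<j\le n$ let $f_{i,j}:\mathbb{R}_{\ge0}^N\to\mathbb{R}$ be continuous polynomial maps of degree $\le d_{i,j}$, and let $f:\mathbb{R}_{\ge0}^N\to\mathcal{U}_n(\mathbb{R})$ be the function whose value at $t$ is the upper unitriangular matrix with $(i,j)$-entry $f_{i,j}(t)$ for all $1\le i<j\le n$. Then $f$ is a continuous polynomial map. Conversely, every continuous polynomial map $f:\mathbb{R}_{\ge0}^N\to\mathcal{U}_n(\mathbb{R})$ is of this form, i.e. each of its entries $f_{i,j}$, $1\le i<j\le n$, is a continuous polynomial map $\mathbb{R}_{\ge0}^N\to\mathbb{R}$.
   Context: $\mathcal{U}_n(\mathbb{R})$ is the group of upper triangular $n\times n$ real matrices with all diagonal entries equal to $1$, under matrix multiplication, with its usual metric topology. $\mathbb{R}_{\ge0}^N$ is a commutative semigroup under addition, and $\mathbb{R}$ is regarded as the additive group. Let $S$ be a nonempty commutative semigroup (written additively) and $G$ a group with identity $1_G$. A map $f:S\to G$ is a polynomial map of degree $-\infty$ if $f(s)=1_G$ for all $s$, and of degree $0$ if it is constant with value different from $1_G$. Thus degree $\le 0$ means constant. Inductively, for $d\in\{0,1,2,\dots\}$, $f$ is a polynomial map of degree $\le d+1$ if for every $s\in S$ both maps $L_s(f):t\mapsto f(s+t)f(t)^{-1}$ and $R_s(f):t\mapsto f(t)^{-1}f(s+t)$ from $S$ to $G$ are polynomial maps of degree $\le d$. The degree of a polynomial map is the least such $d\in\{-\infty,0,1,2,\dots\}$. A map is a polynomial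 map if it is a polynomial map of degree $\le d$ for some $d$. *)

theory Defs
  imports "HOL-Analysis.Analysis" "HOL-Algebra.Group"
begin

text \<open>
  A commutative semigroup is a subset \<open>S\<close> of a type of class \<^class>\<open>ab_semigroup_add\<close>; the notions
  below are meant for nonempty \<open>S\<close> closed under addition. The values of a map outside \<open>S\<close>
  are irrelevant.
\<close>

definition left_diff :: "('g, 'm) monoid_scheme \<Rightarrow> 'a \<Rightarrow> ('a::ab_semigroup_add \<Rightarrow> 'g) \<Rightarrow> 'a \<Rightarrow> 'g"
  where "left_diff G s f = (\<lambda>t. f (s + t) \<otimes>\<^bsub>G\<^esub> inv\<^bsub>G\<^esub> f t)"

definition right_diff :: "('g, 'm) monoid_scheme \<Rightarrow> 'a \<Rightarrow> ('a::ab_semigroup_add \<Rightarrow> 'g) \<Rightarrow> 'a \<Rightarrow> 'g"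
  where "right_diff G s f = (\<lambda>t. inv\<^bsub>G\<^esub> f t \<otimes>\<^bsub>G\<^esub> f (s + t))"

primrec poly_map_le_nat ::
    "'a::ab_semigroup_add set \<Rightarrow> ('g, 'm) monoid_scheme \<Rightarrow> nat \<Rightarrow> ('a \<Rightarrow> 'g) \<Rightarrow> bool"
  where
    "poly_map_le_nat S G 0 f \<longleftrightarrow> (\<exists>c\<in>carrier G. \<forall>t\<in>S. f t = c)"
  | "poly_map_le_nat S G (Suc d) f \<longleftrightarrow> f \<in> S \<rightarrow> carrier G \<and>
       (\<forall>s\<in>S. poly_map_le_nat S G d (left_diff G s f) \<and> poly_map_le_nat S G d (right_diff G s f))"

text \<open>Degree bounds range over \<open>{-\<infinity>, 0, 1, 2, \<dots>}\<close>, with \<^const>\<open>None\<close> standing for \<open>-\<infinity>\<close>.\<close>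

fun poly_map_le ::
    "'a::ab_semigroup_add set \<Rightarrow> ('g, 'm) monoid_scheme \<Rightarrow> nat option \<Rightarrow> ('a \<Rightarrow> 'g) \<Rightarrow> bool"
  where
    "poly_map_le S G None f \<longleftrightarrow> (\<forall>t\<in>S. f t = \<one>\<^bsub>G\<^esub>)"
  | "poly_map_le S G (Some d) f \<longleftrightarrow> poly_map_le_nat S G d f"

definition poly_map ::
    "'a::ab_semigroup_add set \<Rightarrow> ('g, 'm) monoid_scheme \<Rightarrow> ('a \<Rightarrow> 'g) \<Rightarrow> bool"
  where "poly_map S G f \<longleftrightarrow> (\<exists>d. poly_map_le S G d f)"

definition real_group :: "real monoid"
  where "real_group = \<lparr>carrier = UNIV, monoid.mult = (+), one = 0\<rparr>"

definition nonneg_orthant :: "(real ^ 'N) set"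
  where "nonneg_orthant = {x. \<forall>i. 0 \<le> x $ i}"

text \<open>
  A finite well-ordered (equivalently, finite linearly ordered) index type \<open>'n\<close> with \<open>n\<close> elements
  is order-isomorphic to \<open>{1, \<dots>, n}\<close>, so it carries the notion of an upper triangular matrix;
  the numeral types are instances for every \<open>n \<ge> 1\<close>.
\<close>

definition unitriangular_group :: "(real ^ 'n::{finite,wellorder} ^ 'n::{finite,wellorder}) monoid"
  where "unitriangular_group =
    \<lparr>carrier = {A. (\<forall>i. A $ i $ i = 1) \<and> (\<forall>i j. j < i \<longrightarrow> A $ i $ j = 0)},
     monoid.mult = (**), one = mat 1\<rparr>"

definition unitriangular :: "('n::{finite,wellorder} \<Rightarrow> 'n \<Rightarrow> real) \<Rightarrow> real ^ 'n::{finite,wellorder} ^ 'n::{finite,wellorder}"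
  where "unitriangular a = (\<chi> i j. if i < j then a i j else if i = j then 1 else 0)"

lemma group_real_group: "group real_group"
  unfolding real_group_def
  by (rule groupI) (auto intro: exI[of _ "- x" for x])

lemma nonneg_orthant_add:
  "x \<in> nonneg_orthant \<Longrightarrow> y \<in> nonneg_orthant \<Longrightarrow> x + y \<in> nonneg_orthant"
  by (simp add: nonneg_orthant_def)

lemma nonneg_orthant_nonempty: "nonneg_orthant \<noteq> {}"
  by (auto simp: nonneg_orthant_def intro: exI[of _ 0])

lemma unitriangular_mult_closed:
  fixes A B :: "real ^ 'n::{finite,wellorder} ^ 'n::{finite,wellorder}"
  assumes "A \<in> carrier unitriangular_group" "B \<in> carrier unitriangular_group"
  shows "A ** B \<in> carrier unitriangular_group"
proof -
  have A: "A $ i $ i = 1" "j < i \<Longrightarrow> A $ i $ j = 0" for i j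
    using assms(1) by (auto simp: unitriangular_group_def)
  have B: "B $ i $ i = 1" "j < i \<Longrightarrow> B $ i $ j = 0" for i j
    using assms(2) by (auto simp: unitriangular_group_def)
  have "(A ** B) $ i $ j = 0" if "j < i" for i j
  proof -
    have "A $ i $ k * B $ k $ j = 0" for k
      using A(2)[of k i] B(2)[of j k] that by (cases "k < i") auto
    then show ?thesis by (auto simp: matrix_matrix_mult_def intro!: sum.neutral)
  qed
  moreover have "(A ** B) $ i $ i = 1" for i
  proof -
    have "A $ i $ k * B $ k $ i = (if k = i then 1 else 0)" for k
      using A(1)[of i] B(1)[of i] A(2)[of k i] B(2)[of i k] by (cases k i rule: linorder_cases) auto
    then show ?thesis by (simp add: matrix_matrix_mult_def)
  qed
  ultimately show ?thesis by (simp add: unitriangular_group_def)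
qed

lemma unitriangular_left_inverse:
  fixes A :: "real ^ 'n::{finite,wellorder} ^ 'n::{finite,wellorder}"
  assumes "A \<in> carrier unitriangular_group"
  shows "\<exists>B\<in>carrier unitriangular_group. B ** A = mat 1"
proof -
  have A: "A $ i $ i = 1" "j < i \<Longrightarrow> A $ i $ j = 0" for i j
    using assms by (auto simp: unitriangular_group_def)
  have "det A = 1"
    using A by (subst det_upperdiagonal) auto
  then obtain B where B: "B ** A = mat 1"
    by (metis invertible_det_nz invertible_left_inverse zero_neq_one)
  have BA: "(\<Sum>k\<in>UNIV. B $ i $ k * A $ k $ j) = (if i = j then 1 else 0)" for i j
    using arg_cong[OF B, of "\<lambda>M. M $ i $ j"] by (simp add: matrix_matrix_mult_def mat_def)
  have zero: "B $ i $ j = 0" if "j < i" for i j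
    using that
  proof (induction j rule: less_induct)
    case (less j)
    have "B $ i $ k * A $ k $ j = (if k = j then B $ i $ j else 0)" for k
      using less.IH[of k] less.prems A(1)[of j] A(2)[of j k]
      by (cases k j rule: linorder_cases) auto
    then show ?case using BA[of i j] less.prems by simp
  qed
  have "B $ i $ i = 1" for i
  proof -
    have "B $ i $ k * A $ k $ i = (if k = i then B $ i $ i else 0)" for k
      using zero[of k i] A(1)[of i] A(2)[of i k] by (cases k i rule: linorder_cases) auto
    then show ?thesis using BA[of i i] by simp
  qed
  with zero B show ?thesis by (auto simp: unitriangular_group_def)
qed

lemma group_unitriangular_group: "group unitriangular_group"
proof (rule groupI)
  fix A :: "real ^ 'n::{finite,wellorder} ^ 'n::{finite,wellorder}"
  assume "A \<in> carrier unitriangular_group"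
  then show "\<exists>B\<in>carrier unitriangular_group. B \<otimes>\<^bsub>unitriangular_group\<^esub> A = \<one>\<^bsub>unitriangular_group\<^esub>"
    using unitriangular_left_inverse[of A] by (simp add: unitriangular_group_def)
next
  fix A B :: "real ^ 'n::{finite,wellorder} ^ 'n::{finite,wellorder}"
  assume "A \<in> carrier unitriangular_group" "B \<in> carrier unitriangular_group"
  then show "A \<otimes>\<^bsub>unitriangular_group\<^esub> B \<in> carrier unitriangular_group"
    using unitriangular_mult_closed[of A B] by (simp add: unitriangular_group_def)
qed (simp_all add: unitriangular_group_def matrix_mul_assoc, simp add: mat_def)

end

theory Submission
  imports Defs
begin

text \<open>
  For maps into the additive group of a commutative ring the polynomial maps form a filtered
  algebra, and everything else takes place in this algebra, one matrix entry at a time.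

  If \<open>f\<close> has polynomial entries, bound their degrees by numbers that grow so fast with the distance
  from the diagonal that the bounds for \<open>(i, k)\<close> and \<open>(k, j)\<close>, where \<open>i < k < j\<close>, add up to at most
  the bound for \<open>(i, j)\<close>. Such a system of bounds survives matrix inversion, because the entries of
  \<open>f\<inverse>\<close> above the diagonal are signed sums of products of entries of \<open>f\<close> along increasing chains of
  indices (\<open>entries_inverse\<close>). Moreover, writing \<open>\<Delta>\<^sub>s f\<close> for \<open>t \<mapsto> f (s + t) - f t\<close>,
  \<^item> the left difference of \<open>f\<close> is \<open>1 + (\<Delta>\<^sub>s f) f\<inverse>\<close>, and
  \<^item> the right difference of \<open>f\<close> is \<open>1 + f\<inverse> (\<Delta>\<^sub>s f)\<close>,

  and since \<open>\<Delta>\<^sub>s\<close> lowers every degree by one, both satisfy the system with all bounds lowered by one,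
  which is again a system of the same kind. After finitely many differences all
  entries above the diagonal vanish (\<open>poly_map_of_entries\<close>).

  Conversely, let \<open>g = f\<inverse> (f \<circ> (s +))\<close> be a right difference of \<open>f\<close>, whose entries may be assumed to
  be polynomial by induction on the degree of \<open>f\<close>. As \<open>f (s + t) = f t g t\<close> and \<open>g\<close> is unitriangular,
  \<open>\<Delta>\<^sub>s f\<^sub>i\<^sub>j\<close> is the sum of \<open>f\<^sub>i\<^sub>k g\<^sub>k\<^sub>j\<close> over the columns \<open>k < j\<close>; so the columns of \<open>f\<close> are seen to be polynomial
  one after the other (\<open>entries_of_poly_map_le_nat\<close>). The degree bounds have to be uniform in \<open>f\<close>, since
  they are applied to the right differences for all \<open>s\<close> at once.

  Continuity passes between \<open>f\<close> and its entries because the topology on matrices is the entrywise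
  one.
\<close>

section \<open>The filtered algebra of polynomial functions\<close>

text \<open>
  The functions of degree less than \<open>d\<close>. Counting from the zero function, instead of from the
  constants, gives \<open>-\<infinity>\<close> and the natural degrees a common scale on which every difference, also
  that of a constant, lowers the bound by exactly one.
\<close>

primrec deg_less :: "'a::ab_semigroup_add set \<Rightarrow> nat \<Rightarrow> ('a \<Rightarrow> 'b::comm_ring) \<Rightarrow> bool"
  where
    "deg_less S 0 f \<longleftrightarrow> (\<forall>t\<in>S. f t = 0)"
  | "deg_less S (Suc d) f \<longleftrightarrow> (\<forall>s\<in>S. deg_less S d (\<lambda>t. f (s + t) - f t))"

lemma deg_less_add: "deg_less S d f \<Longrightarrow> deg_less S d g \<Longrightarrow> deg_less S d (\<lambda>t. f t + g t)"
proof (induction d arbitrary: f g)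
  case (Suc d)
  have "deg_less S d (\<lambda>t. (f (s + t) - f t) + (g (s + t) - g t))" if "s \<in> S" for s
    using that Suc.prems by (intro Suc.IH) auto
  then show ?case by (simp add: algebra_simps)
qed simp

lemma deg_less_uminus: "deg_less S d f \<Longrightarrow> deg_less S d (\<lambda>t. - f t)"
proof (induction d arbitrary: f)
  case (Suc d)
  have "deg_less S d (\<lambda>t. - (f (s + t) - f t))" if "s \<in> S" for s
    using that Suc.prems by (intro Suc.IH) auto
  then show ?case by (simp add: algebra_simps)
qed simp

context
  fixes S :: "'a::ab_semigroup_add set"
  assumes add_closed: "\<forall>s\<in>S. \<forall>t\<in>S. s + t \<in> S"
begin

lemma deg_less_cong:
  assumes "deg_less S d g" "\<And>t. t \<in> S \<Longrightarrow> f t = g t"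
  shows "deg_less S d f"
  using assms
proof (induction d arbitrary: f g)
  case (Suc d)
  have "deg_less S d (\<lambda>t. f (s + t) - f t)" if "s \<in> S" for s
    by (rule Suc.IH[of "\<lambda>t. g (s + t) - g t"]) (use that Suc.prems add_closed in auto)
  then show ?case by simp
qed simp

lemma deg_less_zero: "(\<And>t. t \<in> S \<Longrightarrow> f t = 0) \<Longrightarrow> deg_less S d f"
  by (induction d arbitrary: f) (auto simp: add_closed)

lemma deg_less_Suc: "deg_less S d f \<Longrightarrow> deg_less S (Suc d) f"
  by (induction d arbitrary: f) (auto simp: add_closed)

lemma deg_less_mono:
  assumes "deg_less S d f" "d \<le> e"
  shows "deg_less S e f"
  using assms(2,1) by (induction e rule: dec_induct) (auto intro: deg_less_Suc simp del: deg_less.simps)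

lemma deg_less_const: "(\<And>t. t \<in> S \<Longrightarrow> f t = c) \<Longrightarrow> deg_less S (Suc d) f"
  by (auto intro!: deg_less_zero simp: add_closed)

lemma deg_less_diff_step:
  assumes "deg_less S d f" "s \<in> S"
  shows "deg_less S (d - 1) (\<lambda>t. f (s + t) - f t)"
  using assms by (cases d) (auto simp: add_closed)

lemma deg_less_sum:
  assumes "\<And>k. k \<in> K \<Longrightarrow> deg_less S d (f k)"
  shows "deg_less S d (\<lambda>t. \<Sum>k\<in>K. f k t)"
  using assms
  by (induction K rule: infinite_finite_induct) (auto intro: deg_less_zero deg_less_add)

text \<open>
  Degrees add under multiplication, by the Leibniz rule
  \<open>\<Delta>\<^sub>s (f g) = \<Delta>\<^sub>s f \<Delta>\<^sub>s g + \<Delta>\<^sub>s f g + f \<Delta>\<^sub>s g\<close>. A bound of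
  zero makes that factor the zero function, so that the product satisfies every bound \<open>c\<close>.
\<close>

lemma deg_less_mult:
  assumes "deg_less S a f" "deg_less S b g" "a \<noteq> 0 \<Longrightarrow> b \<noteq> 0 \<Longrightarrow> a + b \<le> Suc c"
  shows "deg_less S c (\<lambda>t. f t * g t)"
  using assms
proof (induction "a + b" arbitrary: a b c f g rule: less_induct)
  case less
  show ?case
  proof (cases "a = 0 \<or> b = 0")
    case True
    with less.prems show ?thesis by (auto intro!: deg_less_zero)
  next
    case False
    with less.prems(3) obtain a' b' c' where eq: "a = Suc a'" "b = Suc b'" "c = Suc c'"
      by (metis Suc_le_mono add_Suc_right add_Suc add_is_0 le_zero_eq nat.exhaust)
    have le: "a' + b' \<le> c'"
      using less.prems(3) eq by simp
    have "deg_less S c' (\<lambda>t. f (s + t) * g (s + t) - f t * g t)" if "s \<in> S" for s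
    proof -
      have f': "deg_less S a' (\<lambda>t. f (s + t) - f t)" and g': "deg_less S b' (\<lambda>t. g (s + t) - g t)"
        using less.prems that eq by auto
      have "deg_less S c' (\<lambda>t. (f (s + t) - f t) * (g (s + t) - g t))"
        using le by (intro less.hyps[OF _ f' g']) (auto simp: eq)
      moreover have "deg_less S c' (\<lambda>t. (f (s + t) - f t) * g t)"
        using le by (intro less.hyps[OF _ f' less.prems(2)]) (auto simp: eq)
      moreover have "deg_less S c' (\<lambda>t. f t * (g (s + t) - g t))"
        using le by (intro less.hyps[OF _ less.prems(1) g']) (auto simp: eq)
      ultimately have "deg_less S c' (\<lambda>t. (f (s + t) - f t) * (g (s + t) - g t)
          + ((f (s + t) - f t) * g t + f t * (g (s + t) - g t)))"
        by (intro deg_less_add)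
      then show ?thesis by (simp add: algebra_simps)
    qed
    then show ?thesis by (simp add: eq)
  qed
qed

end

section \<open>Polynomial maps into the additive group of the reals\<close>

lemma inv_real_group: "inv\<^bsub>real_group\<^esub> x = - x"
  by (rule group.inv_equality[OF group_real_group]) (simp_all add: real_group_def)

lemma left_diff_real_group: "left_diff real_group s f = (\<lambda>t. f (s + t) - f t)"
  by (simp add: left_diff_def inv_real_group) (simp add: real_group_def)

lemma right_diff_real_group: "right_diff real_group s f = (\<lambda>t. f (s + t) - f t)"
  by (simp add: right_diff_def inv_real_group) (simp add: real_group_def)

text \<open>
  The two definitions of degree meet at the constants: a function with vanishing differences is
  constant because \<open>f s = f (t + s) = f (s + t) = f t\<close>.
\<close>

lemma poly_map_le_nat_real_group_iff:
  assumes add_closed: "\<forall>s\<in>S. \<forall>t\<in>S. s + t \<in> S"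
  shows "poly_map_le_nat S real_group d f \<longleftrightarrow> deg_less S (Suc d) f"
proof (induction d arbitrary: f)
  case 0
  have "\<exists>c. \<forall>t\<in>S. f t = c" if "\<forall>s\<in>S. \<forall>t\<in>S. f (s + t) - f t = 0"
    using that by (metis add.commute eq_iff_diff_eq_0)
  then show ?case
    by (auto simp: real_group_def add_closed)
next
  case (Suc d)
  then show ?case
    by (simp add: left_diff_real_group right_diff_real_group del: deg_less.simps)
       (simp add: real_group_def)
qed

lemma poly_map_real_group_iff:
  assumes add_closed: "\<forall>s\<in>S. \<forall>t\<in>S. s + t \<in> S"
  shows "poly_map S real_group f \<longleftrightarrow> (\<exists>d. deg_less S d f)"
proof
  assume "poly_map S real_group f"
  then obtain d where d: "poly_map_le S real_group d f"
    by (auto simp: poly_map_def)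
  show "\<exists>d. deg_less S d f"
  proof (cases d)
    case None
    with d have "deg_less S 0 f" by (simp add: real_group_def)
    then show ?thesis ..
  next
    case (Some e)
    with d show ?thesis
      using poly_map_le_nat_real_group_iff[OF add_closed, of e f]
      by (auto simp del: deg_less.simps)
  qed
next
  assume "\<exists>d. deg_less S d f"
  then obtain d where "deg_less S (Suc d) f"
    using deg_less_Suc[OF add_closed] by blast
  then have "poly_map_le S real_group (Some d) f"
    using poly_map_le_nat_real_group_iff[OF add_closed] by (simp del: deg_less.simps)
  then show "poly_map S real_group f"
    unfolding poly_map_def by blast
qed

section \<open>Entries of products and inverses of unitriangular matrices\<close>

lemma unitriangular_groupD:
  assumes "A \<in> carrier unitriangular_group"
  shows "A $ i $ i = 1" "j < i \<Longrightarrow> A $ i $ j = 0"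
  using assms by (auto simp: unitriangular_group_def)

lemma matrix_eq_unitriangular_entries:
  assumes "A \<in> carrier unitriangular_group"
  shows "A = unitriangular (\<lambda>i j. A $ i $ j)"
  using unitriangular_groupD[OF assms]
  by (auto simp: unitriangular_def vec_eq_iff elim: neqE dest: less_asym)

lemma unitriangular_in_carrier: "unitriangular a \<in> carrier unitriangular_group"
  by (auto simp: unitriangular_def unitriangular_group_def dest: less_asym)

lemma unitriangular_group_mult: "A \<otimes>\<^bsub>unitriangular_group\<^esub> B = A ** B"
  by (simp add: unitriangular_group_def)

lemma unitriangular_group_inv:
  fixes A :: "real ^ 'n::{finite,wellorder} ^ 'n::{finite,wellorder}"
  assumes "A \<in> carrier unitriangular_group"
  shows "inv\<^bsub>unitriangular_group\<^esub> A \<in> carrier unitriangular_group"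
    "inv\<^bsub>unitriangular_group\<^esub> A ** A = mat 1" "A ** inv\<^bsub>unitriangular_group\<^esub> A = mat 1"
  using group.inv_closed[OF group_unitriangular_group assms]
    group.l_inv[OF group_unitriangular_group assms] group.r_inv[OF group_unitriangular_group assms]
  by (simp_all add: unitriangular_group_def)

text \<open>
  Degree bounds for the entries above the diagonal. Weights bound degrees strictly, so a
  product of functions of weights \<open>a\<close> and \<open>b\<close> has weight \<open>a + b - 1\<close>; this is the reason for the \<open>Suc\<close>.
\<close>

definition superadditive_weight :: "('n::linorder \<Rightarrow> 'n \<Rightarrow> nat) \<Rightarrow> bool"
  where "superadditive_weight w \<longleftrightarrow> (\<forall>i k j. i < k \<longrightarrow> k < j \<longrightarrow> w i k + w k j \<le> Suc (w i j))"

lemma superadditive_weightD: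
  "superadditive_weight w \<Longrightarrow> i < k \<Longrightarrow> k < j \<Longrightarrow> w i k + w k j \<le> Suc (w i j)"
  by (auto simp: superadditive_weight_def)

lemma superadditive_weight_diff:
  assumes "superadditive_weight w"
  shows "superadditive_weight (\<lambda>i j. w i j - 1)"
  unfolding superadditive_weight_def
proof (intro allI impI)
  fix i k j :: 'a
  assume "i < k" "k < j"
  from superadditive_weightD[OF assms this] show "w i k - 1 + (w k j - 1) \<le> Suc (w i j - 1)"
    by linarith
qed

text \<open>
  Bounds for all entries are dominated by a superadditive weight that is affine in the distance
  from the diagonal, measured by the position of an index in the linear order. The constant term
  one is the price of strict bounds: it makes superadditivity an equality.
\<close>

lemma superadditive_weight_exists:
  fixes d :: "'n::{finite,wellorder} \<Rightarrow> 'n \<Rightarrow> nat"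
  obtains w e where "superadditive_weight w" "\<And>i j. i < j \<Longrightarrow> d i j \<le> w i j"
    "\<And>i j. i < j \<Longrightarrow> w i j \<le> e"
proof
  define c where "c = (\<Sum>i\<in>UNIV. \<Sum>j\<in>UNIV. d i j)"
  define pos where "pos = (\<lambda>i::'n. card {..<i})"
  define w where "w = (\<lambda>i j. c * (pos j - pos i) + 1)"
  have pos_less: "pos i < pos j" if "i < j" for i j
    unfolding pos_def using that by (intro psubset_card_mono) auto
  show "superadditive_weight w"
    unfolding superadditive_weight_def
  proof (intro allI impI)
    fix i k j :: 'n
    assume "i < k" "k < j"
    then have "pos j - pos i = (pos k - pos i) + (pos j - pos k)"
      using pos_less[of i k] pos_less[of k j] by simp
    then show "w i k + w k j \<le> Suc (w i j)"
      by (simp add: w_def distrib_left)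
  qed
  show "d i j \<le> w i j" if "i < j" for i j
  proof -
    have "1 \<le> pos j - pos i"
      using pos_less[OF that] by linarith
    then have *: "c \<le> c * (pos j - pos i)"
      using mult_le_mono2[of 1 _ c] by simp
    have "d i j \<le> (\<Sum>j\<in>UNIV. d i j)"
      by (rule member_le_sum) auto
    also have "\<dots> \<le> c"
      unfolding c_def by (rule member_le_sum) auto
    also note *
    finally show ?thesis by (simp add: w_def)
  qed
  show "w i j \<le> c * CARD('n) + 1" for i j
  proof -
    have "pos j \<le> CARD('n)"
      unfolding pos_def by (rule card_mono) auto
    then have "pos j - pos i \<le> CARD('n)"
      by simp
    then show ?thesis by (simp add: w_def)
  qed
qed

lemma left_diff_entry:
  fixes f :: "'a::ab_semigroup_add \<Rightarrow> real ^ 'n::{finite,wellorder} ^ 'n::{finite,wellorder}"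
  assumes "f t \<in> carrier unitriangular_group" "i \<noteq> j"
  shows "left_diff unitriangular_group s f t $ i $ j =
    (\<Sum>k\<in>UNIV. (f (s + t) $ i $ k - f t $ i $ k) * (inv\<^bsub>unitriangular_group\<^esub> f t) $ k $ j)"
proof -
  have "(\<Sum>k\<in>UNIV. f t $ i $ k * (inv\<^bsub>unitriangular_group\<^esub> f t) $ k $ j) = 0"
    using arg_cong[OF unitriangular_group_inv(3)[OF assms(1)], of "\<lambda>M. M $ i $ j"] assms(2)
    by (simp add: matrix_matrix_mult_def mat_def)
  then show ?thesis
    by (simp add: left_diff_def unitriangular_group_mult matrix_matrix_mult_def left_diff_distrib
        sum_subtractf)
qed

lemma right_diff_entry:
  fixes f :: "'a::ab_semigroup_add \<Rightarrow> real ^ 'n::{finite,wellorder} ^ 'n::{finite,wellorder}"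
  assumes "f t \<in> carrier unitriangular_group" "i \<noteq> j"
  shows "right_diff unitriangular_group s f t $ i $ j =
    (\<Sum>k\<in>UNIV. (inv\<^bsub>unitriangular_group\<^esub> f t) $ i $ k * (f (s + t) $ k $ j - f t $ k $ j))"
proof -
  have "(\<Sum>k\<in>UNIV. (inv\<^bsub>unitriangular_group\<^esub> f t) $ i $ k * f t $ k $ j) = 0"
    using arg_cong[OF unitriangular_group_inv(2)[OF assms(1)], of "\<lambda>M. M $ i $ j"] assms(2)
    by (simp add: matrix_matrix_mult_def mat_def)
  then show ?thesis
    by (simp add: right_diff_def unitriangular_group_mult matrix_matrix_mult_def right_diff_distrib
        sum_subtractf)
qed

lemma unitriangular_diffs_in_carrier:
  fixes f :: "'a::ab_semigroup_add \<Rightarrow> real ^ 'n::{finite,wellorder} ^ 'n::{finite,wellorder}"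
  assumes "f t \<in> carrier unitriangular_group" "f (s + t) \<in> carrier unitriangular_group"
  shows "left_diff unitriangular_group s f t \<in> carrier unitriangular_group"
    "right_diff unitriangular_group s f t \<in> carrier unitriangular_group"
  using assms
  by (simp_all add: left_diff_def right_diff_def unitriangular_group_mult
      unitriangular_mult_closed unitriangular_group_inv(1))

text \<open>
  In \<open>f (s + t) = f t g t\<close>, with \<open>g\<close> the right difference, the term
  for \<open>k = j\<close> is \<open>f\<^sub>i\<^sub>j g\<^sub>j\<^sub>j = f\<^sub>i\<^sub>j\<close>, which is moved to the left; the terms with \<open>k > j\<close> vanish.
\<close>

lemma entry_diff_eq_sum:
  fixes f :: "'a::ab_semigroup_add \<Rightarrow> real ^ 'n::{finite,wellorder} ^ 'n::{finite,wellorder}"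
  assumes "f t \<in> carrier unitriangular_group" "f (s + t) \<in> carrier unitriangular_group"
  shows "f (s + t) $ i $ j - f t $ i $ j =
    (\<Sum>k\<in>{..<j}. f t $ i $ k * right_diff unitriangular_group s f t $ k $ j)"
proof -
  define g where "g = right_diff unitriangular_group s f t"
  have g: "g \<in> carrier unitriangular_group"
    unfolding g_def using assms by (rule unitriangular_diffs_in_carrier)
  have "f t ** g = f (s + t)"
    by (simp add: g_def right_diff_def unitriangular_group_mult matrix_mul_assoc
        unitriangular_group_inv(3)[OF assms(1)])
  from arg_cong[OF this, of "\<lambda>M. M $ i $ j"]
  have "f (s + t) $ i $ j = (\<Sum>k\<in>UNIV. f t $ i $ k * g $ k $ j)"
    by (simp add: matrix_matrix_mult_def)
  also have "\<dots> = (\<Sum>k\<in>insert j {..<j}. f t $ i $ k * g $ k $ j)"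
    using unitriangular_groupD(2)[OF g] by (intro sum.mono_neutral_right) (auto simp: not_less_iff_gr_or_eq)
  also have "\<dots> = f t $ i $ j + (\<Sum>k\<in>{..<j}. f t $ i $ k * g $ k $ j)"
    using unitriangular_groupD(1)[OF g] by simp
  finally show ?thesis by (simp add: g_def)
qed

context
  fixes S :: "'a::ab_semigroup_add set"
  assumes add_closed: "\<forall>s\<in>S. \<forall>t\<in>S. s + t \<in> S"
begin

text \<open>
  Back substitution in \<open>B A = 1\<close>: \<open>B\<^sub>i\<^sub>j\<close> is minus the sum of \<open>B\<^sub>i\<^sub>k A\<^sub>k\<^sub>j\<close> over \<open>i \<le> k < j\<close>. The term for
  \<open>k = i\<close> is \<open>A\<^sub>i\<^sub>j\<close>, and superadditivity covers the others, whose entries of \<open>B\<close> lie in earlier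
  columns.
\<close>

lemma entries_inverse:
  fixes A B :: "'a \<Rightarrow> real ^ 'n::{finite,wellorder} ^ 'n::{finite,wellorder}"
  assumes w: "superadditive_weight w"
    and A: "\<And>t. t \<in> S \<Longrightarrow> A t \<in> carrier unitriangular_group"
    and B: "\<And>t. t \<in> S \<Longrightarrow> B t \<in> carrier unitriangular_group"
    and BA: "\<And>t. t \<in> S \<Longrightarrow> B t ** A t = mat 1"
    and entries: "\<And>i j. i < j \<Longrightarrow> deg_less S (w i j) (\<lambda>t. A t $ i $ j)"
    and "i < j"
  shows "deg_less S (w i j) (\<lambda>t. B t $ i $ j)"
  using \<open>i < j\<close>
proof (induction j rule: less_induct)
  case (less j)
  have eq: "B t $ i $ j = - (\<Sum>k\<in>UNIV - {j}. B t $ i $ k * A t $ k $ j)" if "t \<in> S" for t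
  proof -
    have "(\<Sum>k\<in>UNIV. B t $ i $ k * A t $ k $ j) = 0"
      using arg_cong[OF BA[OF that], of "\<lambda>M. M $ i $ j"] less.prems
      by (simp add: matrix_matrix_mult_def mat_def)
    moreover have "(\<Sum>k\<in>UNIV. B t $ i $ k * A t $ k $ j)
        = B t $ i $ j * A t $ j $ j + (\<Sum>k\<in>UNIV - {j}. B t $ i $ k * A t $ k $ j)"
      by (rule sum.remove) auto
    ultimately show ?thesis
      using unitriangular_groupD(1)[OF A[OF that]] by simp
  qed
  have "deg_less S (w i j) (\<lambda>t. B t $ i $ k * A t $ k $ j)" if "k \<noteq> j" for k
  proof -
    consider "k < i" | "k = i" | "i < k" "k < j" | "j < k"
      using \<open>k \<noteq> j\<close> by (metis linorder_less_linear)
    then show ?thesis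
    proof cases
      case 1
      then show ?thesis
        using unitriangular_groupD(2)[OF B] by (intro deg_less_zero[OF add_closed]) auto
    next
      case 2
      then show ?thesis
        by (intro deg_less_cong[OF add_closed entries[OF less.prems]])
          (auto simp: unitriangular_groupD(1)[OF B])
    next
      case 3
      then show ?thesis
        using superadditive_weightD[OF w 3]
        by (intro deg_less_mult[OF add_closed less.IH entries]) auto
    next
      case 4
      then show ?thesis
        using unitriangular_groupD(2)[OF A] by (intro deg_less_zero[OF add_closed]) auto
    qed
  qed
  then have "deg_less S (w i j) (\<lambda>t. - (\<Sum>k\<in>UNIV - {j}. B t $ i $ k * A t $ k $ j))"
    by (intro deg_less_uminus deg_less_sum[OF add_closed]) auto
  then show ?case
    using eq by (rule deg_less_cong[OF add_closed])
qed

section \<open>Maps with polynomial entries are polynomial\<close>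

text \<open>
  Meant for \<open>D = \<Delta>\<^sub>s f\<close> and \<open>B = f\<inverse>\<close>, whose products are the differences of \<open>f\<close> up to the identity
  matrix. Diagonal entries of \<open>B\<close> are one and leave the lowered weights of \<open>D\<close> alone, and in every
  other nonzero term superadditivity leaves room for the lowering.
\<close>

lemma entries_strict_mult_unitriangular:
  fixes B D :: "'a \<Rightarrow> real ^ 'n::{finite,wellorder} ^ 'n::{finite,wellorder}"
  assumes w: "superadditive_weight w"
    and B: "\<And>t. t \<in> S \<Longrightarrow> B t \<in> carrier unitriangular_group"
    and B_entries: "\<And>i j. i < j \<Longrightarrow> deg_less S (w i j) (\<lambda>t. B t $ i $ j)"
    and D: "\<And>t i j. t \<in> S \<Longrightarrow> j \<le> i \<Longrightarrow> D t $ i $ j = 0"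
    and D_entries: "\<And>i j. i < j \<Longrightarrow> deg_less S (w i j - 1) (\<lambda>t. D t $ i $ j)"
    and ij: "i < j"
  shows "deg_less S (w i j - 1) (\<lambda>t. \<Sum>k\<in>UNIV. D t $ i $ k * B t $ k $ j)"
    and "deg_less S (w i j - 1) (\<lambda>t. \<Sum>k\<in>UNIV. B t $ i $ k * D t $ k $ j)"
proof -
  have "deg_less S (w i j - 1) (\<lambda>t. D t $ i $ k * B t $ k $ j)" for k
  proof -
    consider "k \<le> i" | "i < k" "k < j" | "k = j" | "j < k"
      by (metis linorder_less_linear not_less)
    then show ?thesis
    proof cases
      case 1
      then show ?thesis using D by (intro deg_less_zero[OF add_closed]) auto
    next
      case 2
      then show ?thesis
        using superadditive_weightD[OF w 2]
        by (intro deg_less_mult[OF add_closed D_entries B_entries]) auto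
    next
      case 3
      then show ?thesis
        by (intro deg_less_cong[OF add_closed D_entries[OF ij]])
          (auto simp: unitriangular_groupD(1)[OF B])
    next
      case 4
      then show ?thesis
        using unitriangular_groupD(2)[OF B] by (intro deg_less_zero[OF add_closed]) auto
    qed
  qed
  then show "deg_less S (w i j - 1) (\<lambda>t. \<Sum>k\<in>UNIV. D t $ i $ k * B t $ k $ j)"
    by (intro deg_less_sum[OF add_closed])
  have "deg_less S (w i j - 1) (\<lambda>t. B t $ i $ k * D t $ k $ j)" for k
  proof -
    consider "k < i" | "k = i" | "i < k" "k < j" | "j \<le> k"
      by (metis linorder_less_linear not_less)
    then show ?thesis
    proof cases
      case 1
      then show ?thesis
        using unitriangular_groupD(2)[OF B] by (intro deg_less_zero[OF add_closed]) auto
    next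
      case 2
      then show ?thesis
        by (intro deg_less_cong[OF add_closed D_entries[OF ij]])
          (auto simp: unitriangular_groupD(1)[OF B])
    next
      case 3
      then show ?thesis
        using superadditive_weightD[OF w 3]
        by (intro deg_less_mult[OF add_closed B_entries D_entries]) auto
    next
      case 4
      then show ?thesis using D by (intro deg_less_zero[OF add_closed]) auto
    qed
  qed
  then show "deg_less S (w i j - 1) (\<lambda>t. \<Sum>k\<in>UNIV. B t $ i $ k * D t $ k $ j)"
    by (intro deg_less_sum[OF add_closed])
qed

text \<open>
  Taking a difference lowers all weights by one, so \<open>e\<close> differences make the entries above the
  diagonal vanish; what remains is the constant identity matrix.
\<close>

lemma poly_map_of_entries:
  fixes f :: "'a \<Rightarrow> real ^ 'n::{finite,wellorder} ^ 'n::{finite,wellorder}"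
  assumes "superadditive_weight w" "\<And>i j. i < j \<Longrightarrow> w i j \<le> e"
    and "\<And>t. t \<in> S \<Longrightarrow> f t \<in> carrier unitriangular_group"
    and "\<And>i j. i < j \<Longrightarrow> deg_less S (w i j) (\<lambda>t. f t $ i $ j)"
  shows "poly_map_le_nat S unitriangular_group e f"
  using assms
proof (induction e arbitrary: w f)
  case 0
  have entry: "f t $ i $ j = 0" if "t \<in> S" "i < j" for t i j
    using 0(2,4)[OF that(2)] that(1) by simp
  have "f t = unitriangular (\<lambda>i j. 0)" if "t \<in> S" for t
  proof -
    have "unitriangular (\<lambda>i j. f t $ i $ j) = unitriangular (\<lambda>i j. 0)"
      using entry[OF that] by (simp add: unitriangular_def vec_eq_iff)
    with matrix_eq_unitriangular_entries[OF 0(3)[OF that]] show ?thesis by simp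
  qed
  then show ?case
    using unitriangular_in_carrier by auto
next
  case (Suc e)
  have bound: "w i j - 1 \<le> e" if "i < j" for i j
    using Suc.prems(2)[OF that] by simp
  have "poly_map_le_nat S unitriangular_group e (left_diff unitriangular_group s f) \<and>
      poly_map_le_nat S unitriangular_group e (right_diff unitriangular_group s f)"
    if s: "s \<in> S" for s
  proof -
    define B where "B = (\<lambda>t. inv\<^bsub>unitriangular_group\<^esub> f t)"
    define D where "D = (\<lambda>t. f (s + t) - f t)"
    have B: "B t \<in> carrier unitriangular_group" "B t ** f t = mat 1" if "t \<in> S" for t
      using unitriangular_group_inv[OF Suc.prems(3)[OF that]] by (simp_all add: B_def)
    have B_entries: "deg_less S (w i j) (\<lambda>t. B t $ i $ j)" if "i < j" for i j
      by (rule entries_inverse[where A = f]; fact Suc.prems(1,3,4) B that)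
    have D: "D t $ i $ j = 0" if "t \<in> S" "j \<le> i" for t i j
      using that unitriangular_groupD[OF Suc.prems(3)] s add_closed
      by (cases "i = j") (auto simp: D_def)
    have D_entries: "deg_less S (w i j - 1) (\<lambda>t. D t $ i $ j)" if "i < j" for i j
      using deg_less_diff_step[OF add_closed Suc.prems(4)[OF that] s] by (simp add: D_def)
    have mult: "deg_less S (w i j - 1) (\<lambda>t. \<Sum>k\<in>UNIV. D t $ i $ k * B t $ k $ j)"
      "deg_less S (w i j - 1) (\<lambda>t. \<Sum>k\<in>UNIV. B t $ i $ k * D t $ k $ j)" if "i < j" for i j
      by (rule entries_strict_mult_unitriangular[where B = B and D = D];
          fact Suc.prems(1) B(1) B_entries D D_entries that)+
    have "deg_less S (w i j - 1) (\<lambda>t. left_diff unitriangular_group s f t $ i $ j)"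
      if "i < j" for i j
    proof -
      have eq: "left_diff unitriangular_group s f t $ i $ j = (\<Sum>k\<in>UNIV. D t $ i $ k * B t $ k $ j)"
        if "t \<in> S" for t
        using left_diff_entry[of f t i j s] Suc.prems(3)[OF that] \<open>i < j\<close> by (simp add: B_def D_def)
      from mult(1)[OF \<open>i < j\<close>] eq show ?thesis
        by (rule deg_less_cong[OF add_closed])
    qed
    moreover have "deg_less S (w i j - 1) (\<lambda>t. right_diff unitriangular_group s f t $ i $ j)"
      if "i < j" for i j
    proof -
      have eq: "right_diff unitriangular_group s f t $ i $ j = (\<Sum>k\<in>UNIV. B t $ i $ k * D t $ k $ j)"
        if "t \<in> S" for t
        using right_diff_entry[of f t i j s] Suc.prems(3)[OF that] \<open>i < j\<close> by (simp add: B_def D_def)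
      from mult(2)[OF \<open>i < j\<close>] eq show ?thesis
        by (rule deg_less_cong[OF add_closed])
    qed
    moreover have "left_diff unitriangular_group s f t \<in> carrier unitriangular_group"
      "right_diff unitriangular_group s f t \<in> carrier unitriangular_group" if "t \<in> S" for t
      using that s add_closed by (simp_all add: unitriangular_diffs_in_carrier Suc.prems(3))
    ultimately show ?thesis
      using superadditive_weight_diff[OF Suc.prems(1)] bound by (intro conjI Suc.IH) auto
  qed
  with Suc.prems(3) show ?case by auto
qed

section \<open>Polynomial maps have polynomial entries\<close>

text \<open>
  The bound \<open>e\<close> must not depend on \<open>f\<close>: the induction hypothesis for \<open>d\<close> is applied to the right
  differences of \<open>f\<close> for all shifts \<open>s\<close>, and their entries need a common degree. For the same reason
  the inner induction over the columns provides a bound for each column that is uniform in \<open>f\<close>.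
\<close>

lemma entries_of_poly_map_le_nat:
  "\<exists>e. \<forall>f :: 'a \<Rightarrow> real ^ 'n::{finite,wellorder} ^ 'n::{finite,wellorder}. poly_map_le_nat S unitriangular_group d f
    \<longrightarrow> (\<forall>i j. deg_less S e (\<lambda>t. f t $ i $ j))"
proof (induction d)
  case 0
  have "deg_less S (Suc 0) (\<lambda>t. f t $ i $ j)"
    if "poly_map_le_nat S unitriangular_group 0 f" for f :: "'a \<Rightarrow> real ^ 'n::{finite,wellorder} ^ 'n::{finite,wellorder}" and i j
  proof -
    from that obtain c where "\<forall>t\<in>S. f t = c" by auto
    then show ?thesis by (intro deg_less_const[OF add_closed, of _ "c $ i $ j"]) auto
  qed
  then show ?case by blast
next
  case (Suc d)
  then obtain e where e: "deg_less S e (\<lambda>t. f t $ i $ j)"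
    if "poly_map_le_nat S unitriangular_group d f" for f :: "'a \<Rightarrow> real ^ 'n::{finite,wellorder} ^ 'n::{finite,wellorder}" and i j
    by blast
  have "\<exists>b. \<forall>f :: 'a \<Rightarrow> real ^ 'n::{finite,wellorder} ^ 'n::{finite,wellorder}. poly_map_le_nat S unitriangular_group (Suc d) f
      \<longrightarrow> (\<forall>i. deg_less S b (\<lambda>t. f t $ i $ j))" for j
  proof (induction j rule: less_induct)
    case (less j)
    then obtain b where b: "\<And>k f i. k < j \<Longrightarrow> poly_map_le_nat S unitriangular_group (Suc d) f
        \<Longrightarrow> deg_less S (b k) (\<lambda>t. f t $ i $ k)"
      by metis
    define c where "c = (\<Sum>k\<in>{..<j}. b k)"
    have "deg_less S (Suc (c + e)) (\<lambda>t. f t $ i $ j)"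
      if f: "poly_map_le_nat S unitriangular_group (Suc d) f"
      for f :: "'a \<Rightarrow> real ^ 'n::{finite,wellorder} ^ 'n::{finite,wellorder}" and i
    proof -
      have "deg_less S (c + e) (\<lambda>t. f (s + t) $ i $ j - f t $ i $ j)" if s: "s \<in> S" for s
      proof -
        define g where "g = right_diff unitriangular_group s f"
        have g: "deg_less S e (\<lambda>t. g t $ k $ j)" for k
          using e f s by (auto simp: g_def)
        have "deg_less S (c + e) (\<lambda>t. f t $ i $ k * g t $ k $ j)" if "k \<in> {..<j}" for k
        proof -
          have "b k \<le> c"
            unfolding c_def using that by (intro member_le_sum) auto
          then show ?thesis
            using that by (intro deg_less_mult[OF add_closed b[OF _ f] g]) auto
        qed
        then have "deg_less S (c + e) (\<lambda>t. \<Sum>k\<in>{..<j}. f t $ i $ k * g t $ k $ j)"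
          by (rule deg_less_sum[OF add_closed])
        moreover have "f (s + t) $ i $ j - f t $ i $ j = (\<Sum>k\<in>{..<j}. f t $ i $ k * g t $ k $ j)"
          if "t \<in> S" for t
          unfolding g_def using f s that add_closed by (intro entry_diff_eq_sum) auto
        ultimately show ?thesis
          by (rule deg_less_cong[OF add_closed])
      qed
      then show ?thesis by simp
    qed
    then show ?case by blast
  qed
  then obtain b where b: "\<And>j f i. poly_map_le_nat S unitriangular_group (Suc d) f
      \<Longrightarrow> deg_less S (b j) (\<lambda>t. (f t :: real ^ 'n::{finite,wellorder} ^ 'n::{finite,wellorder}) $ i $ j)"
    by metis
  have "deg_less S (\<Sum>j\<in>UNIV. b j) (\<lambda>t. f t $ i $ j)"
    if "poly_map_le_nat S unitriangular_group (Suc d) f" for f :: "'a \<Rightarrow> real ^ 'n::{finite,wellorder} ^ 'n::{finite,wellorder}" and i j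
    by (rule deg_less_mono[OF add_closed b[OF that]]) (auto intro: member_le_sum)
  then show ?case by blast
qed

lemma entries_of_poly_map:
  fixes f :: "'a \<Rightarrow> real ^ 'n::{finite,wellorder} ^ 'n::{finite,wellorder}"
  assumes "poly_map S unitriangular_group f"
  shows "t \<in> S \<Longrightarrow> f t \<in> carrier unitriangular_group"
    and "\<exists>e. deg_less S e (\<lambda>t. f t $ i $ j)"
proof -
  have "\<exists>d. poly_map_le_nat S unitriangular_group d f"
  proof -
    from assms obtain d where d: "poly_map_le S unitriangular_group d f"
      by (auto simp: poly_map_def)
    show ?thesis
    proof (cases d)
      case None
      with d have "poly_map_le_nat S unitriangular_group 0 f"
        using group.is_monoid[OF group_unitriangular_group, THEN monoid.one_closed] by auto
      then show ?thesis ..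
    next
      case (Some d')
      with d show ?thesis by auto
    qed
  qed
  then obtain d where d: "poly_map_le_nat S unitriangular_group d f" ..
  then show "t \<in> S \<Longrightarrow> f t \<in> carrier unitriangular_group"
    by (cases d) auto
  show "\<exists>e. deg_less S e (\<lambda>t. f t $ i $ j)"
    using entries_of_poly_map_le_nat d by blast
qed

end

section \<open>Continuous polynomial maps on the orthant\<close>

lemma nonneg_orthant_closed: "\<forall>s\<in>nonneg_orthant. \<forall>t\<in>nonneg_orthant. s + t \<in> nonneg_orthant"
  by (simp add: nonneg_orthant_add)

theorem theorem5:
  shows
    "(\<forall>(a :: 'n::{finite,wellorder} \<Rightarrow> 'n \<Rightarrow> real ^ 'N::finite \<Rightarrow> real) (d :: 'n \<Rightarrow> 'n \<Rightarrow> nat option)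
        (f :: real ^ 'N::finite \<Rightarrow> real ^ 'n::{finite,wellorder} ^ 'n::{finite,wellorder}).
        (\<forall>i j. i < j \<longrightarrow> continuous_on nonneg_orthant (a i j) \<and>
                     poly_map_le nonneg_orthant real_group (d i j) (a i j)) \<and>
        (\<forall>t\<in>nonneg_orthant. f t = unitriangular (\<lambda>i j. a i j t)) \<longrightarrow>
        continuous_on nonneg_orthant f \<and> poly_map nonneg_orthant unitriangular_group f) \<and>
     (\<forall>f :: real ^ 'N::finite \<Rightarrow> real ^ 'n::{finite,wellorder} ^ 'n::{finite,wellorder}.
        continuous_on nonneg_orthant f \<and> poly_map nonneg_orthant unitriangular_group f \<longrightarrow>
        (\<forall>t\<in>nonneg_orthant. f t = unitriangular (\<lambda>i j. f t $ i $ j)) \<and>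
        (\<forall>i j. i < j \<longrightarrow> continuous_on nonneg_orthant (\<lambda>t. f t $ i $ j) \<and>
                     poly_map nonneg_orthant real_group (\<lambda>t. f t $ i $ j)))"
proof (intro conjI allI impI; (elim conjE)?)
  fix a :: "'n \<Rightarrow> 'n \<Rightarrow> real ^ 'N \<Rightarrow> real" and d :: "'n \<Rightarrow> 'n \<Rightarrow> nat option"
    and f :: "real ^ 'N \<Rightarrow> real ^ 'n::{finite,wellorder} ^ 'n::{finite,wellorder}"
  assume a: "\<forall>i j. i < j \<longrightarrow> continuous_on nonneg_orthant (a i j) \<and>
      poly_map_le nonneg_orthant real_group (d i j) (a i j)"
    and f: "\<forall>t\<in>nonneg_orthant. f t = unitriangular (\<lambda>i j. a i j t)"
  have "continuous_on nonneg_orthant (\<lambda>t. unitriangular (\<lambda>i j. a i j t))"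
    unfolding unitriangular_def
  proof (intro continuous_on_vec_lambda)
    fix i j :: 'n
    show "continuous_on nonneg_orthant (\<lambda>t. if i < j then a i j t else if i = j then 1 else 0)"
      using a by (cases "i < j") auto
  qed
  then show "continuous_on nonneg_orthant f"
    using f continuous_on_cong by force
  have "\<exists>e. i < j \<longrightarrow> deg_less nonneg_orthant e (a i j)" for i j
    using a poly_map_real_group_iff[OF nonneg_orthant_closed, of "a i j"]
    unfolding poly_map_def by blast
  then obtain e where e: "i < j \<Longrightarrow> deg_less nonneg_orthant (e i j) (a i j)" for i j
    by metis
  obtain w b where w: "superadditive_weight w" "\<And>i j. i < j \<Longrightarrow> e i j \<le> w i j"
    "\<And>i j. i < j \<Longrightarrow> w i j \<le> b"
    using superadditive_weight_exists by metis
  have "deg_less nonneg_orthant (w i j) (\<lambda>t. f t $ i $ j)" if "i < j" for i j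
  proof -
    have "deg_less nonneg_orthant (w i j) (a i j)"
      using deg_less_mono[OF nonneg_orthant_closed] e w(2) that by blast
    moreover have "f t $ i $ j = a i j t" if "t \<in> nonneg_orthant" for t
      using f that \<open>i < j\<close> by (simp add: unitriangular_def)
    ultimately show ?thesis
      by (rule deg_less_cong[OF nonneg_orthant_closed])
  qed
  then have "poly_map_le_nat nonneg_orthant unitriangular_group b f"
    using w f unitriangular_in_carrier
    by (intro poly_map_of_entries[OF nonneg_orthant_closed]) auto
  then have "poly_map_le nonneg_orthant unitriangular_group (Some b) f"
    by simp
  then show "poly_map nonneg_orthant unitriangular_group f"
    unfolding poly_map_def by blast
next
  fix f :: "real ^ 'N \<Rightarrow> real ^ 'n::{finite,wellorder} ^ 'n::{finite,wellorder}"
  assume cont: "continuous_on nonneg_orthant f"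
    and poly: "poly_map nonneg_orthant unitriangular_group f"
  show "\<forall>t\<in>nonneg_orthant. f t = unitriangular (\<lambda>i j. f t $ i $ j)"
    using matrix_eq_unitriangular_entries entries_of_poly_map(1)[OF nonneg_orthant_closed poly] by blast
  fix i j :: 'n
  show "continuous_on nonneg_orthant (\<lambda>t. f t $ i $ j)"
    using cont by (intro continuous_on_component)
  show "poly_map nonneg_orthant real_group (\<lambda>t. f t $ i $ j)"
    using poly_map_real_group_iff[OF nonneg_orthant_closed]
      entries_of_poly_map(2)[OF nonneg_orthant_closed poly] by blast
qed

end
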